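(* Let $g$ satisfy the growth condition $|g(x)|\leq Kx^{m\operatorname{Re}\rho}e^{x/\beta}$ for all $x>T$, where $K,T,\beta$ are positive constants. Then, for positive real numbers $a,\nu$ and $\mu$, the Borel–Džrbashjan transform $\mathfrak B_{\nu,\mu}$, with respect to $u$ and evaluated at $s=\omega$, of the function $u\mapsto\mathcal M_{\rho,m}[e^{-ax}g(x)](u\omega,v,\omega)$ satisfies $$\mathfrak B_{\nu,\mu}\big[\mathcal M_{\rho,m}[e^{-ax}g(x)](u\omega,v,\omega)\big](\omega)=\omega^{\nu\mu-1}\,\mathcal M_{\rho,m}\left\{\frac{g(x)}{x^{\nu\mu}}\,H^{1,1}_{1,1}\left[\frac\omega x\left|\begin{array}{l}(1-\nu\mu,1)\\(0,\frac1\nu)\end{array}\right.\right]\right\}(a\omega,v,\omega).$$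
   Context: Here $\rho\in\mathbb C$ with $\operatorname{Re}\rho>0$, $m\in\mathbb N=\{1,2,\dots\}$, $v\in\mathbb C$ and $\omega\in\mathbb R^+$ (positive reals). For $u,v\in\mathbb C$, $\omega\in\mathbb R^+$ and a function $f$ on $(0,\infty)$, $$\mathcal M_{\rho,m}[f(x)](u,v,\omega)=\int_0^\infty \frac{e^{-ux-v/x}}{(x^m+\omega^m)^\rho}f(\omega x)\,dx,$$ where $x$ inside the brackets is a dummy variable and the function being transformed may depend on the parameter $\omega$. The Borel–Džrbashjan transform is $$\mathfrak B_{\nu,\mu}[h(u)](s)=\nu s^{\nu\mu-1}\int_0^\infty e^{-s^\nu u^\nu}u^{\nu\mu-1}h(u)\,du,\qquad \nu,\mu>0.$$ The $H$-function appearing here is the Mellin–Barnes integral over a suitable contour $\mathcal C$, $$H^{1,1}_{1,1}\left[z\left|\begin{array}{l}(1-\nu\mu,1)\\(0,\frac1\nu)\end{array}\right.\right]=\frac1{2\pi i}\int_{\mathcal C}\Gamma\Big(\frac\theta\nu\Big)\Gamma(\nu\mu-\theta)\,z^{-\theta}\,d\theta.$$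
   Formalization: g is taken measurable and the identity is proved when the right-hand integral converges absolutely; growth alone does not ensure this (it can fail if a<1/β or near x=0), but it is shown to follow if a>1/β and e^{-v/x}g(ωx) is integrable on (0,T/ω]. *)

theory Defs
  imports "HOL-Analysis.Analysis"
begin

definition M_integrand ::
  "complex \<Rightarrow> nat \<Rightarrow> (real \<Rightarrow> complex) \<Rightarrow> complex \<Rightarrow> complex \<Rightarrow> real \<Rightarrow> real \<Rightarrow> complex" where
  "M_integrand \<rho> m f u v \<omega> x =
     exp (- (u * of_real x) - v / of_real x) / (of_real (x ^ m + \<omega> ^ m) powr \<rho>) * f (\<omega> * x)"

definition M_transform ::
  "complex \<Rightarrow> nat \<Rightarrow> (real \<Rightarrow> complex) \<Rightarrow> complex \<Rightarrow> complex \<Rightarrow> real \<Rightarrow> complex" where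
  "M_transform \<rho> m f u v \<omega> = (LINT x:{0<..}|lebesgue. M_integrand \<rho> m f u v \<omega> x)"

text \<open>A divergent Lebesgue integral has the default value 0, so convergence of the
  transforms is recorded by separate predicates.\<close>

definition M_converges ::
  "complex \<Rightarrow> nat \<Rightarrow> (real \<Rightarrow> complex) \<Rightarrow> complex \<Rightarrow> complex \<Rightarrow> real \<Rightarrow> bool" where
  "M_converges \<rho> m f u v \<omega> \<longleftrightarrow> M_integrand \<rho> m f u v \<omega> absolutely_integrable_on {0<..}"

definition BD_integrand ::
  "real \<Rightarrow> real \<Rightarrow> (real \<Rightarrow> complex) \<Rightarrow> real \<Rightarrow> real \<Rightarrow> complex" where
  "BD_integrand \<nu> \<mu> h s u =
     of_real (exp (- (s powr \<nu> * u powr \<nu>)) * u powr (\<nu> * \<mu> - 1)) * h u"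

definition BD_transform :: "real \<Rightarrow> real \<Rightarrow> (real \<Rightarrow> complex) \<Rightarrow> real \<Rightarrow> complex" where
  "BD_transform \<nu> \<mu> h s =
     of_real (\<nu> * s powr (\<nu> * \<mu> - 1)) * (LINT u:{0<..}|lebesgue. BD_integrand \<nu> \<mu> h s u)"

definition BD_converges :: "real \<Rightarrow> real \<Rightarrow> (real \<Rightarrow> complex) \<Rightarrow> real \<Rightarrow> bool" where
  "BD_converges \<nu> \<mu> h s \<longleftrightarrow> BD_integrand \<nu> \<mu> h s absolutely_integrable_on {0<..}"

text \<open>The Fox function $H^{1,1}_{1,1}[z \mid (a,A); (b,B)]$, as the Mellin--Barnes integral of
  $\Gamma(b + B\theta)\,\Gamma(1 - a - A\theta)\,z^{-\theta}$ along the upward vertical line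
  $\theta = c + it$, whence $d\theta = i\,dt$.  The line is a suitable contour when it has the
  poles of the first Gamma factor on its left and those of the second on its right; for
  $a = 1 - \nu\mu$, $A = 1$, $b = 0$, $B = 1/\nu$ this means $0 < c < \nu\mu$.\<close>

definition H11 ::
  "real \<Rightarrow> complex \<Rightarrow> real \<Rightarrow> complex \<Rightarrow> real \<Rightarrow> complex \<Rightarrow> complex" where
  "H11 c a A b B z =
     1 / (2 * of_real pi * \<i>) *
     (LINT t|lebesgue. (let \<theta> = Complex c t in
        Gamma (b + of_real B * \<theta>) * Gamma (1 - a - of_real A * \<theta>) * z powr (- \<theta>)) * \<i>)"

end

theory Submission
  imports Defs "HOL-Probability.Characteristic_Functions" "HOL-Probability.Sinc_Integral"
begin

text \<open>The $H$-function is a Laplace transform in disguise: writing $p = \nu\mu$,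
  \[ y^{-p}\, H^{1,1}_{1,1}[\omega/y] = \nu \int_0^\infty e^{-yu - (\omega u)^\nu} u^{p-1}\,du . \]
  This follows by inserting Euler's integral for $\Gamma(p-\theta)$ into the Mellin--Barnes
  integral and exchanging the order of integration, because the remaining inner integral is the
  Cahen--Mellin formula for $e^{-(\omega u)^\nu}$, i.e. Fourier inversion for
  $x \mapsto e^{cx - e^x}$.  Setting $y = \omega x$, the claimed identity becomes an exchange of
  the integrals over $x$ and $u$.  Since the kernel is positive, convergence of the
  right-hand side is exactly absolute convergence of the double integral, so Tonelli's theorem
  provides everything else.\<close>

subsection \<open>Fourier inversion\<close>

text \<open>The Gaussian is its own Fourier transform. This is the characteristic function of the
  standard normal law, with the density's factor 1/sqrt(2 pi) moved to the other side.\<close>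

lemma normal_char_integral:
  fixes y :: real
  shows "(\<integral>t. iexp (t * y) * of_real (exp (- t\<^sup>2 / 2)) \<partial>lborel) = of_real (sqrt (2 * pi) * exp (- y\<^sup>2 / 2))"
proof -
  have "char std_normal_distribution y = (\<integral>t. std_normal_density t *\<^sub>R iexp (y * t) \<partial>lborel)"
    unfolding char_def by (subst integral_density) (auto simp: normal_density_nonneg)
  also have "\<dots> = (\<integral>t. of_real (1 / sqrt (2 * pi)) * (iexp (t * y) * of_real (exp (- t\<^sup>2 / 2))) \<partial>lborel)"
    by (intro Bochner_Integration.integral_cong)
       (simp_all add: std_normal_density_def scaleR_conv_of_real mult_ac)
  also have "\<dots> = of_real (1 / sqrt (2 * pi)) * (\<integral>t. iexp (t * y) * of_real (exp (- t\<^sup>2 / 2)) \<partial>lborel)"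
    by (rule integral_mult_right_zero)
  finally show ?thesis
    by (simp add: char_std_normal_distribution field_simps)
qed

lemma integrable_exp_minus_square: "integrable lborel (\<lambda>t::real. exp (- t\<^sup>2 / 2))"
proof -
  have "integrable lborel (\<lambda>t. sqrt (2 * pi) * std_normal_density t)"
    by (intro integrable_mult_right integrable_normal_density) auto
  thus ?thesis
    by (simp add: std_normal_density_def)
qed

text \<open>A Gaussian factor makes the double integral absolutely convergent.\<close>

lemma mollified_fourier_inversion:
  fixes f :: "real \<Rightarrow> complex"
  assumes f: "integrable lborel f" and e: "e > 0"
  shows "(\<integral>t. iexp (- (t * s)) * of_real (exp (- (e * t)\<^sup>2 / 2)) * (\<integral>x. iexp (t * x) * f x \<partial>lborel) \<partial>lborel) =
         of_real (sqrt (2 * pi)) * (\<integral>y. f (s + e * y) * of_real (exp (- y\<^sup>2 / 2)) \<partial>lborel)"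
proof -
  let ?F = "\<lambda>t x. iexp (t * (x - s)) * of_real (exp (- (e * t)\<^sup>2 / 2)) * f x"
  have [measurable]: "f \<in> borel_measurable borel"
    using f by (simp add: integrable_iff_bounded)
  have gauss: "integrable lborel (\<lambda>t. exp (- (e * t)\<^sup>2 / 2))"
    using lborel_integrable_real_affine[OF integrable_exp_minus_square, of e 0] e by simp
  have int: "integrable (lborel \<Otimes>\<^sub>M lborel) (\<lambda>(t, x). ?F t x)"
  proof (rule lborel_pair.Fubini_integrable)
    show "integrable lborel (\<lambda>t. \<integral>x. norm (case (t, x) of (t, x) \<Rightarrow> ?F t x) \<partial>lborel)"
      using gauss by (simp add: norm_mult)
    show "AE t in lborel. integrable lborel (\<lambda>x. case (t, x) of (t, x) \<Rightarrow> ?F t x)"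
    proof (rule AE_I2)
      fix t
      have "integrable lborel (\<lambda>x. ?F t x)"
        by (rule Bochner_Integration.integrable_bound[OF integrable_norm[OF f]])
           (auto simp: norm_mult intro!: AE_I2 mult_left_le_one_le)
      thus "integrable lborel (\<lambda>x. case (t, x) of (t, x) \<Rightarrow> ?F t x)" by simp
    qed
  qed measurable
  \<comment> \<open>Rescaling t by 1/e reduces the t-integral to \<open>normal_char_integral\<close>
    at (x - s)/e, which is a Gaussian bump of width e centred at s.\<close>
  have inner: "(\<integral>t. ?F t x \<partial>lborel) = of_real (sqrt (2 * pi) * exp (- ((x - s) / e)\<^sup>2 / 2) / e) * f x" for x
  proof -
    have "(\<integral>t. iexp (t * (x - s)) * of_real (exp (- (e * t)\<^sup>2 / 2)) \<partial>lborel) =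
          (1 / e) *\<^sub>R (\<integral>t. iexp (t * ((x - s) / e)) * of_real (exp (- t\<^sup>2 / 2)) \<partial>lborel)"
      by (subst lborel_integral_real_affine[of "1 / e" _ 0]) (use e in \<open>simp_all\<close>)
    thus ?thesis using e
      unfolding normal_char_integral by (simp add: scaleR_conv_of_real mult_ac)
  qed
  have "?F t x = iexp (- (t * s)) * of_real (exp (- (e * t)\<^sup>2 / 2)) * (iexp (t * x) * f x)" for t x
    by (simp add: exp_add[symmetric] algebra_simps)
  hence "(\<integral>t. iexp (- (t * s)) * of_real (exp (- (e * t)\<^sup>2 / 2)) * (\<integral>x. iexp (t * x) * f x \<partial>lborel) \<partial>lborel) =
        (\<integral>t. (\<integral>x. ?F t x \<partial>lborel) \<partial>lborel)"
    by (simp only: integral_mult_right_zero)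
  also have "\<dots> = (\<integral>x. (\<integral>t. ?F t x \<partial>lborel) \<partial>lborel)"
    by (rule lborel_pair.Fubini_integral[OF int, symmetric])
  also have "\<dots> = (\<integral>x. of_real (sqrt (2 * pi) * exp (- ((x - s) / e)\<^sup>2 / 2) / e) * f x \<partial>lborel)"
    by (simp only: inner)
  \<comment> \<open>Substituting x = s + e y moves the parameter e from the bump into the argument
    of f, so the limit e -> 0 can later be taken under the integral. The Jacobian e cancels the 1/e
    of the bump.\<close>
  also have "\<dots> = e *\<^sub>R (\<integral>y. of_real (sqrt (2 * pi) / e) * (f (s + e * y) * of_real (exp (- y\<^sup>2 / 2))) \<partial>lborel)"
    by (subst lborel_integral_real_affine[of e _ s]) (use e in \<open>simp_all add: mult_ac\<close>)
  also have "\<dots> = of_real (sqrt (2 * pi)) * (\<integral>y. f (s + e * y) * of_real (exp (- y\<^sup>2 / 2)) \<partial>lborel)"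
    unfolding integral_mult_right_zero using e by (simp add: scaleR_conv_of_real)
  finally show ?thesis .
qed

text \<open>Both sides of \<open>mollified_fourier_inversion\<close> converge as the width tends to
  0, by dominated convergence. On the left integrability of \<phi> provides the dominating function;
  on the right boundedness of f does, and continuity gives the pointwise limit. Uniqueness of limits
  then identifies the two.\<close>

lemma fourier_inversion:
  fixes f \<phi> :: "real \<Rightarrow> complex"
  assumes f: "integrable lborel f" and cont: "continuous_on UNIV f" and bdd: "\<And>x. norm (f x) \<le> B"
    and \<phi>: "\<And>t. \<phi> t = (\<integral>x. iexp (t * x) * f x \<partial>lborel)" and int_\<phi>: "integrable lborel \<phi>"
  shows "(\<integral>t. iexp (- (t * s)) * \<phi> t \<partial>lborel) = of_real (2 * pi) * f s"
proof (rule LIMSEQ_unique)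
  define e where "e n = inverse (real (Suc n))" for n
  have e0: "e \<longlonglongrightarrow> 0" unfolding e_def by (rule LIMSEQ_inverse_real_of_nat)
  have epos: "e n > 0" for n by (simp add: e_def)
  have [measurable]: "\<phi> \<in> borel_measurable borel"
    using int_\<phi> by (simp add: integrable_iff_bounded)
  have [measurable]: "f \<in> borel_measurable borel"
    using f by (simp add: integrable_iff_bounded)
  let ?I = "\<lambda>n. \<integral>t. iexp (- (t * s)) * of_real (exp (- (e n * t)\<^sup>2 / 2)) * \<phi> t \<partial>lborel"
  show "?I \<longlonglongrightarrow> (\<integral>t. iexp (- (t * s)) * \<phi> t \<partial>lborel)"
  proof (rule integral_dominated_convergence)
    show "integrable lborel (\<lambda>t. norm (\<phi> t))" using int_\<phi> by simp
    show "AE t in lborel. (\<lambda>n. iexp (- (t * s)) * of_real (exp (- (e n * t)\<^sup>2 / 2)) * \<phi> t)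
            \<longlonglongrightarrow> iexp (- (t * s)) * \<phi> t"
    proof (rule AE_I2)
      fix t
      have "(\<lambda>n. iexp (- (t * s)) * of_real (exp (- (e n * t)\<^sup>2 / 2)) * \<phi> t)
            \<longlonglongrightarrow> iexp (- (t * s)) * of_real (exp (- (0 * t)\<^sup>2 / 2)) * \<phi> t"
        by (intro tendsto_intros e0) auto
      thus "(\<lambda>n. iexp (- (t * s)) * of_real (exp (- (e n * t)\<^sup>2 / 2)) * \<phi> t)
            \<longlonglongrightarrow> iexp (- (t * s)) * \<phi> t" by simp
    qed
    show "AE t in lborel. norm (iexp (- (t * s)) * of_real (exp (- (e n * t)\<^sup>2 / 2)) * \<phi> t) \<le> norm (\<phi> t)" for n
      by (auto simp: norm_mult intro!: AE_I2 mult_left_le_one_le)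
  qed measurable
  have "(\<lambda>n. \<integral>y. f (s + e n * y) * of_real (exp (- y\<^sup>2 / 2)) \<partial>lborel) \<longlonglongrightarrow>
        (\<integral>y. f s * of_real (exp (- y\<^sup>2 / 2)) \<partial>lborel)"
  proof (rule integral_dominated_convergence)
    show "integrable lborel (\<lambda>y. B * exp (- y\<^sup>2 / 2))"
      by (intro integrable_mult_right integrable_exp_minus_square)
    show "AE y in lborel. (\<lambda>n. f (s + e n * y) * of_real (exp (- y\<^sup>2 / 2))) \<longlonglongrightarrow> f s * of_real (exp (- y\<^sup>2 / 2))"
    proof (rule AE_I2)
      fix y
      have "(\<lambda>n. s + e n * y) \<longlonglongrightarrow> s + 0 * y" by (intro tendsto_intros e0)
      hence "(\<lambda>n. f (s + e n * y)) \<longlonglongrightarrow> f s"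
        using continuous_on_tendsto_compose[OF cont, of "\<lambda>n. s + e n * y"] by simp
      thus "(\<lambda>n. f (s + e n * y) * of_real (exp (- y\<^sup>2 / 2))) \<longlonglongrightarrow> f s * of_real (exp (- y\<^sup>2 / 2))"
        by (intro tendsto_intros)
    qed
    show "AE y in lborel. norm (f (s + e n * y) * of_real (exp (- y\<^sup>2 / 2))) \<le> B * exp (- y\<^sup>2 / 2)" for n
      using bdd by (auto simp: norm_mult intro!: AE_I2 mult_right_mono)
  qed measurable
  hence "(\<lambda>n. of_real (sqrt (2 * pi)) * (\<integral>y. f (s + e n * y) * of_real (exp (- y\<^sup>2 / 2)) \<partial>lborel)) \<longlonglongrightarrow>
        of_real (sqrt (2 * pi)) * (\<integral>y. f s * of_real (exp (- y\<^sup>2 / 2)) \<partial>lborel)"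
    by (intro tendsto_intros)
  also have "(\<lambda>n. of_real (sqrt (2 * pi)) * (\<integral>y. f (s + e n * y) * of_real (exp (- y\<^sup>2 / 2)) \<partial>lborel)) = ?I"
    using mollified_fourier_inversion[OF f epos, of s] by (simp add: \<phi>)
  \<comment> \<open>The second factor sqrt(2 pi) is the total mass of the Gaussian, i.e.
    \<open>normal_char_integral\<close> at 0.\<close>
  also have "of_real (sqrt (2 * pi)) * (\<integral>y. f s * of_real (exp (- y\<^sup>2 / 2)) \<partial>lborel) = of_real (2 * pi) * f s"
    using normal_char_integral[of 0] by (simp flip: of_real_mult)
  finally show "?I \<longlonglongrightarrow> of_real (2 * pi) * f s" .
qed

subsection \<open>The Gamma function on vertical lines\<close>

text \<open>Euler's integral after the substitution of exp x for its variable. In this form the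
  dependence on Im z is that of a Fourier transform over the whole line.\<close>

lemma Gamma_integral_exp_substitution:
  assumes "Re z > 0"
  shows "integrable lborel (\<lambda>x::real. exp (z * of_real x - of_real (exp x)))" (is ?P)
    and "(\<integral>x. exp (z * of_real x - of_real (exp x)) \<partial>lborel) = Gamma z" (is ?Q)
proof -
  let ?f = "\<lambda>t::real. complex_of_real t powr (z - 1) / of_real (exp t)"
  let ?g = "\<lambda>x::real. exp (z * of_real x - of_real (exp x))"
  have img: "exp ` (UNIV :: real set) = {0<..}"
    by (auto simp: image_iff) (metis exp_ln)
  have "?f absolutely_integrable_on exp ` UNIV \<and> integral (exp ` UNIV) ?f = Gamma z"
    unfolding img using absolutely_integrable_Gamma_integral'[OF assms]
      Gamma_integral_complex'[OF assms] by (auto simp: integral_unique)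
  hence "(\<lambda>x. \<bar>exp x\<bar> *\<^sub>R ?f (exp x)) absolutely_integrable_on UNIV \<and>
         integral UNIV (\<lambda>x. \<bar>exp x\<bar> *\<^sub>R ?f (exp x)) = Gamma z"
    by (subst has_absolute_integral_change_of_variables_real)
       (auto intro!: derivative_eq_intros simp: inj_on_def)
  moreover have "(\<lambda>x. \<bar>exp x\<bar> *\<^sub>R ?f (exp x)) = ?g"
    by (auto simp: fun_eq_iff powr_def scaleR_conv_of_real exp_diff algebra_simps
             simp flip: exp_of_real)
  ultimately have *: "?g absolutely_integrable_on UNIV" "integral UNIV ?g = Gamma z" by simp_all
  \<comment> \<open>The change of variables is carried out over \<open>lebesgue\<close>, whereas the
    product measures are formed over \<open>lborel\<close>. For a Borel function the completion
    affects neither integrability nor the integral.\<close>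
  have meas: "?g \<in> borel_measurable lborel" by measurable
  show ?P using *(1) integrable_completion[OF meas] by (simp add: set_integrable_def)
  have "(LINT x:UNIV|lebesgue. ?g x) = Gamma z"
    using set_lebesgue_integral_eq_integral(2)[OF *(1)] *(2) by simp
  thus ?Q using integral_completion[OF meas] by (simp add: set_lebesgue_integral_def)
qed

lemma Gamma_vertical_measurable:
  assumes "c > 0"
  shows "(\<lambda>t. Gamma (Complex c t)) \<in> borel_measurable borel"
proof -
  have [simp]: "Complex c t \<notin> \<int>\<^sub>\<le>\<^sub>0" for t
    using assms by (auto simp: complex_eq_iff elim!: nonpos_Ints_cases)
  have "continuous_on UNIV (\<lambda>t. Complex c t)"
    unfolding Complex_eq by (intro continuous_intros)
  hence "continuous_on UNIV (\<lambda>t. Gamma (Complex c t))"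
    by (rule continuous_on_compose2[where t = "- \<int>\<^sub>\<le>\<^sub>0", rotated]) (auto intro: continuous_on_Gamma)
  thus ?thesis by (rule borel_measurable_continuous_onI)
qed

text \<open>The triangle inequality for Euler's integral: the modulus of its integrand depends on z
  through Re z only, and equals the integrand for Re z.\<close>

lemma norm_Gamma_le:
  assumes "Re z > 0"
  shows "norm (Gamma z) \<le> Gamma (Re z)"
proof -
  have pos: "Re (of_real (Re z) :: complex) > 0" using assms by simp
  have "norm (Gamma z) \<le> (\<integral>x. norm (exp (z * of_real x - of_real (exp x))) \<partial>lborel)"
    by (subst Gamma_integral_exp_substitution(2)[OF assms, symmetric]) (rule integral_norm_bound)
  moreover have "complex_of_real (\<integral>x. norm (exp (z * of_real x - of_real (exp x))) \<partial>lborel) = (\<integral>x. exp (of_real (Re z) * of_real x - of_real (exp x)) \<partial>lborel)"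
    by (subst integral_complex_of_real[symmetric], intro Bochner_Integration.integral_cong)
       (auto simp flip: exp_of_real)
  hence "(\<integral>x. norm (exp (z * of_real x - of_real (exp x))) \<partial>lborel) = Gamma (Re z)"
    unfolding Gamma_integral_exp_substitution(2)[OF pos] by (simp add: Gamma_complex_of_real)
  ultimately show ?thesis by simp
qed

text \<open>Two steps of $\Gamma(z) = \Gamma(z+1)/z$ already give the decay $O(t^{-2})$, so Stirling's
  formula is not needed.\<close>

lemma integrable_Gamma_vertical:
  assumes c: "c > 0"
  shows "integrable lborel (\<lambda>t. Gamma (Complex c t))"
proof (rule Bochner_Integration.integrable_bound)
  \<comment> \<open>The first summand will bound |Gamma(c + it)| itself, the second t^2 times it;
    their sum therefore bounds (1 + t^2) |Gamma(c + it)|.\<close>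
  let ?C = "Gamma c + Gamma (c + 2)"
  show "integrable lborel (\<lambda>t. ?C * inverse (1 + t\<^sup>2))"
    using integrable_inverse_1_plus_square
    by (intro integrable_mult_right) (simp add: set_integrable_def)
  show "(\<lambda>t. Gamma (Complex c t)) \<in> borel_measurable lborel"
    using Gamma_vertical_measurable[OF c] by simp
  show "AE t in lborel. norm (Gamma (Complex c t)) \<le> norm (?C * inverse (1 + t\<^sup>2))"
  proof (rule AE_I2)
    fix t
    let ?z = "Complex c t"
    have ni: "w \<notin> \<int>\<^sub>\<le>\<^sub>0" if "Re w > 0" for w :: complex
      using that by (auto elim!: nonpos_Ints_cases)
    have "Gamma (?z + 1 + 1) = (?z + 1) * Gamma (?z + 1)"
      by (rule Gamma_plus1, rule ni) (use c in simp)
    also have "Gamma (?z + 1) = ?z * Gamma ?z"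
      by (rule Gamma_plus1, rule ni) (use c in simp)
    finally have "norm (Gamma (?z + 1 + 1)) = norm (?z + 1) * norm ?z * norm (Gamma ?z)"
      by (simp add: norm_mult)
    \<comment> \<open>Both factors have imaginary part t, so each has modulus at least |t|.\<close>
    moreover have "t\<^sup>2 \<le> norm (?z + 1) * norm ?z"
      using mult_mono[OF abs_Im_le_cmod[of "?z + 1"] abs_Im_le_cmod[of ?z]]
      by (simp add: power2_eq_square)
    ultimately have "t\<^sup>2 * norm (Gamma ?z) \<le> norm (Gamma (?z + 1 + 1))"
      by (simp add: mult_right_mono)
    also have "\<dots> \<le> Gamma (c + 2)"
      using norm_Gamma_le[of "?z + 1 + 1"] c by (simp add: add.assoc)
    finally have "(1 + t\<^sup>2) * norm (Gamma ?z) \<le> ?C"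
      using norm_Gamma_le[of ?z] c by (simp add: algebra_simps)
    moreover have "1 + t\<^sup>2 > 0"
      by (simp add: add_pos_nonneg)
    moreover have "?C \<ge> 0"
      using c by (intro add_nonneg_nonneg less_imp_le[OF Gamma_real_pos]) auto
    ultimately show "norm (Gamma ?z) \<le> norm (?C * inverse (1 + t\<^sup>2))"
      by (simp add: abs_mult field_simps)
  qed
qed

text \<open>On the logarithmic scale t -> Gamma(c + it) is the Fourier transform of exp(c x - exp
  x). Inversion at x = ln w returns w^c exp(-w), and the modulus w^(-c) of the power in the
  integrand cancels w^c.\<close>

lemma cahen_mellin:
  assumes c: "c > 0" and w: "w > 0"
  shows "integrable lborel (\<lambda>t. Gamma (Complex c t) * of_real w powr - Complex c t)" (is ?P)
    and "(\<integral>t. Gamma (Complex c t) * of_real w powr - Complex c t \<partial>lborel) = of_real (2 * pi * exp (- w))" (is ?Q)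
proof -
  let ?f = "\<lambda>x::real. exp (of_real c * of_real x - of_real (exp x) :: complex)"
  have norm_f: "norm (?f x) = exp (c * x - exp x)" for x
    by simp
  \<comment> \<open>The exponent c x - exp x is largest at x = ln c, which gives the constant; the
    inequality is 1 + s \<le> exp s at s = x - ln c.\<close>
  have bdd: "norm (?f x) \<le> exp (c * ln c - c)" for x
  proof -
    have "c * (x - ln c) + c = c * (1 + (x - ln c))" by (simp add: algebra_simps)
    also have "\<dots> \<le> c * exp (x - ln c)"
      using c by (intro mult_left_mono exp_ge_add_one_self) auto
    also have "\<dots> = exp x" using c by (simp add: exp_diff)
    finally show ?thesis unfolding norm_f by (simp add: algebra_simps)
  qed
  have \<phi>: "Gamma (Complex c t) = (\<integral>x. iexp (t * x) * ?f x \<partial>lborel)" for t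
    using Gamma_integral_exp_substitution(2)[of "Complex c t"] c
    by (simp add: Complex_eq algebra_simps flip: exp_add)
  have f: "integrable lborel ?f"
    using Gamma_integral_exp_substitution(1)[of "of_real c"] c by simp
  have eq: "of_real w powr - Complex c t = of_real (w powr - c) * iexp (- (t * ln w))" for t
    using w by (simp add: powr_def Ln_of_real Complex_eq algebra_simps flip: exp_of_real exp_add exp_minus)
  have "(\<integral>t. iexp (- (t * ln w)) * Gamma (Complex c t) \<partial>lborel) = of_real (2 * pi) * ?f (ln w)"
    by (rule fourier_inversion[OF f _ bdd \<phi> integrable_Gamma_vertical[OF c]])
       (intro continuous_intros)
  hence "of_real (w powr - c) * (\<integral>t. iexp (- (t * ln w)) * Gamma (Complex c t) \<partial>lborel) =
         of_real (w powr - c) * (of_real (2 * pi) * ?f (ln w))"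
    by (simp only:)
  moreover have "?f (ln w) = of_real (w powr c * exp (- w))"
    using w by (simp add: powr_def exp_diff exp_minus divide_inverse mult_ac flip: exp_of_real)
  moreover have "w powr - c * w powr c = 1"
    using w by (simp flip: powr_add)
  ultimately show ?Q
    unfolding eq by (simp add: mult_ac flip: integral_mult_right_zero of_real_mult)
  show ?P
    by (rule Bochner_Integration.integrable_bound
          [OF integrable_mult_right[OF integrable_Gamma_vertical[OF c], of "of_real (w powr - c)"]])
       (use Gamma_vertical_measurable[OF c] w in \<open>auto simp: eq norm_mult\<close>)
qed

text \<open>Substituting \<nu> t for t leads back to \<open>cahen_mellin\<close> with c/\<nu> and
  w^\<nu> in place of c and w; the Jacobian contributes the factor \<nu>.\<close>

lemma cahen_mellin_scaled:
  assumes c: "c > 0" and w: "w > 0" and \<nu>: "\<nu> > 0"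
  shows "integrable lborel (\<lambda>t. Gamma (of_real (1 / \<nu>) * Complex c t) * of_real w powr - Complex c t)" (is ?P)
    and "(\<integral>t. Gamma (of_real (1 / \<nu>) * Complex c t) * of_real w powr - Complex c t \<partial>lborel) =
           of_real (2 * pi * \<nu> * exp (- (w powr \<nu>)))" (is ?Q)
proof -
  let ?G = "\<lambda>t. Gamma (of_real (1 / \<nu>) * Complex c t) * of_real w powr - Complex c t"
  have eq: "?G (0 + \<nu> * t) = Gamma (Complex (c / \<nu>) t) * of_real (w powr \<nu>) powr - Complex (c / \<nu>) t" for t
  proof -
    have "of_real (1 / \<nu>) * Complex c (0 + \<nu> * t) = Complex (c / \<nu>) t"
      using \<nu> by (simp add: complex_eq_iff)
    moreover have "complex_of_real w powr - Complex c (0 + \<nu> * t) = of_real (w powr \<nu>) powr - Complex (c / \<nu>) t"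
    proof -
      have "- Complex c (0 + \<nu> * t) * of_real (ln w) = - Complex (c / \<nu>) t * of_real (\<nu> * ln w)"
        using \<nu> by (simp add: complex_eq_iff)
      thus ?thesis
        using w by (simp add: powr_def Ln_of_real ln_powr del: of_real_mult)
    qed
    ultimately show ?thesis by simp
  qed
  have c': "c / \<nu> > 0" "w powr \<nu> > 0" using c \<nu> w by auto
  show ?P
    using cahen_mellin(1)[OF c'] lborel_integrable_real_affine_iff[of \<nu> ?G 0] \<nu> unfolding eq by simp
  show ?Q
    using cahen_mellin(2)[OF c'] \<nu> unfolding lborel_integral_real_affine[of \<nu> ?G 0, OF less_imp_neq[OF \<nu>, symmetric]] eq
    by (simp add: scaleR_conv_of_real mult_ac)
qed

subsection \<open>The $H$-function as a Laplace integral\<close>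

text \<open>Up to the factor $y^p$ this is the kernel representation with $z = \omega/y$ and $e^x = yu$;
  on the logarithmic scale Euler's integral is a Fourier integral over the whole line.\<close>

lemma mellin_barnes_log:
  assumes c: "0 < c" "c < p" and \<nu>: "\<nu> > 0" and z: "z > 0"
  shows "integrable lborel (\<lambda>x. exp (p * x - exp x - (z * exp x) powr \<nu>))" (is ?P)
    and "(\<lambda>t. Gamma (of_real (1 / \<nu>) * Complex c t) * Gamma (of_real p - Complex c t) * of_real z powr - Complex c t)
           \<in> borel_measurable borel" (is ?M)
    and "(\<integral>t. Gamma (of_real (1 / \<nu>) * Complex c t) * Gamma (of_real p - Complex c t)
             * of_real z powr - Complex c t \<partial>lborel) =
           of_real (2 * pi * \<nu> * (\<integral>x. exp (p * x - exp x - (z * exp x) powr \<nu>) \<partial>lborel))" (is ?Q)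
proof -
  let ?G = "\<lambda>t. Gamma (of_real (1 / \<nu>) * Complex c t)"
  let ?F = "\<lambda>t x. ?G t * of_real z powr - Complex c t * exp ((of_real p - Complex c t) * of_real x - of_real (exp x))"
  have p: "p > 0" using c by simp
  have int1: "integrable lborel (\<lambda>x. exp (p * x - exp x))"
    using integrable_norm[OF Gamma_integral_exp_substitution(1)[of "of_real p"]] p by simp
  show ?P
    by (rule Bochner_Integration.integrable_bound[OF int1]) auto
  have int2: "integrable lborel (\<lambda>x. exp ((p - c) * x - exp x))"
    using integrable_norm[OF Gamma_integral_exp_substitution(1)[of "of_real (p - c)"]] c by simp
  have intG: "integrable lborel (\<lambda>t. ?G t * of_real z powr - Complex c t)"
    by (rule cahen_mellin_scaled) fact+
  \<comment> \<open>At base 1 the power is constantly 1, so this isolates the Gamma factor and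
    yields its measurability.\<close>
  have "integrable lborel (\<lambda>t. ?G t * of_real 1 powr - Complex c t)"
    by (rule cahen_mellin_scaled) (use c \<nu> in auto)
  hence [measurable]: "?G \<in> borel_measurable borel"
    by (simp add: integrable_iff_bounded)
  have [measurable]: "(\<lambda>t. ?G t * of_real z powr - Complex c t) \<in> borel_measurable borel"
    using intG by (simp add: integrable_iff_bounded)
  have cplx: "(\<lambda>t. Complex c t) = (\<lambda>t. of_real c + \<i> * of_real t)"
    by (auto simp: complex_eq_iff)
  have [measurable]: "(\<lambda>t. Complex c t) \<in> borel_measurable borel"
    unfolding cplx by measurable
  \<comment> \<open>Gamma(p - \<theta>) on the line through c is Gamma on the line through p - c
    with t reflected.\<close>
  have "(\<lambda>t. Gamma (Complex (p - c) (0 + (-1) * t))) \<in> borel_measurable borel"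
    using lborel_integrable_real_affine[OF integrable_Gamma_vertical[of "p - c"], of "-1" 0] c
    by (simp add: integrable_iff_bounded)
  hence [measurable]: "(\<lambda>t. Gamma (of_real p - Complex c t)) \<in> borel_measurable borel"
    by (simp add: Complex_eq algebra_simps)
  have "(\<lambda>t. ?G t * of_real z powr - Complex c t * Gamma (of_real p - Complex c t)) \<in> borel_measurable borel"
    by measurable
  thus ?M by (simp add: mult_ac)
  \<comment> \<open>The modulus splits into a function of t times a function of x. The first is
    integrable because c > 0, the second because c < p, so the contour condition is what permits the
    exchange.\<close>
  have norm_F: "norm (?F t x) = norm (?G t * of_real z powr - Complex c t) * exp ((p - c) * x - exp x)" for t x
    unfolding norm_mult by simp
  have int: "integrable (lborel \<Otimes>\<^sub>M lborel) (\<lambda>(t, x). ?F t x)"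
  proof (rule lborel_pair.Fubini_integrable)
    show "integrable lborel (\<lambda>t. \<integral>x. norm (case (t, x) of (t, x) \<Rightarrow> ?F t x) \<partial>lborel)"
      unfolding prod.case norm_F using integrable_norm[OF intG] by simp
    show "AE t in lborel. integrable lborel (\<lambda>x. case (t, x) of (t, x) \<Rightarrow> ?F t x)"
      unfolding prod.case
      by (intro AE_I2 integrable_mult_right Gamma_integral_exp_substitution(1)) (use c in simp)
  qed measurable
  have inner: "(\<integral>t. ?F t x \<partial>lborel) = of_real (2 * pi * \<nu> * exp (p * x - exp x - (z * exp x) powr \<nu>))" for x
  proof -
    have zx: "z * exp x > 0" using z by simp
    \<comment> \<open>The part exp(-\<theta> x) of Euler's integrand merges with z^(-\<theta>) into
      (z exp x)^(-\<theta>), so the t-integral is the scaled Cahen-Mellin integral at w = z exp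
      x.\<close>
    have "?F t x = of_real (exp (p * x - exp x)) * (?G t * of_real (z * exp x) powr - Complex c t)" for t
    proof -
      have "of_real (z * exp x) powr - Complex c t = of_real z powr - Complex c t * exp (- Complex c t * of_real x)"
      proof -
        have "Ln (complex_of_real (z * exp x)) = of_real (ln z) + of_real x"
          using z by (subst Ln_of_real) (simp_all add: ln_mult)
        thus ?thesis
          using z by (simp add: powr_def Ln_of_real ring_distribs exp_diff exp_minus exp_add field_simps del: of_real_mult)
      qed
      thus ?thesis
        by (simp add: mult_ac flip: exp_of_real exp_add) (simp add: algebra_simps)
    qed
    hence "(\<integral>t. ?F t x \<partial>lborel) = of_real (exp (p * x - exp x)) * of_real (2 * pi * \<nu> * exp (- ((z * exp x) powr \<nu>)))"
      by (simp only: integral_mult_right_zero cahen_mellin_scaled(2)[OF c(1) zx \<nu>])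
    also have "\<dots> = of_real (2 * pi * \<nu> * (exp (p * x - exp x) * exp (- ((z * exp x) powr \<nu>))))"
      by simp
    finally show ?thesis by (simp only: exp_add[symmetric]) simp
  qed
  have "(\<integral>t. ?G t * Gamma (of_real p - Complex c t) * of_real z powr - Complex c t \<partial>lborel) =
        (\<integral>t. (\<integral>x. ?F t x \<partial>lborel) \<partial>lborel)"
    using Gamma_integral_exp_substitution(2)[of "of_real p - Complex c t" for t] c
    by (intro Bochner_Integration.integral_cong) (simp_all add: mult_ac)
  also have "\<dots> = (\<integral>x. (\<integral>t. ?F t x \<partial>lborel) \<partial>lborel)"
    by (rule lborel_pair.Fubini_integral[OF int, symmetric])
  also have "\<dots> = of_real (\<integral>x. 2 * pi * \<nu> * exp (p * x - exp x - (z * exp x) powr \<nu>) \<partial>lborel)"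
    by (simp only: inner integral_complex_of_real)
  finally show ?Q by simp
qed

text \<open>Substitute exp x = y u in \<open>mellin_barnes_log\<close> with z = \<omega>/y: then z
  exp x becomes \<omega> u, and dx = du/u lowers the exponent p to p - 1. The Laplace integral does
  not contain c, so all lines with 0 < c < p give the same value of the H-function.\<close>

lemma H11_eq_laplace_integral:
  assumes c: "0 < c" "c < p" and \<nu>: "\<nu> > 0" and \<omega>: "\<omega> > 0" and y: "y > 0"
  defines "k \<equiv> \<lambda>u. exp (- (y * u)) * (exp (- (\<omega> powr \<nu> * u powr \<nu>)) * u powr (p - 1))"
  shows "integrable (lebesgue_on {0<..}) k" (is ?P)
    and "H11 c (of_real (1 - p)) 1 0 (1 / \<nu>) (of_real (\<omega> / y)) =
           of_real (\<nu> * y powr p * (\<integral>u. k u \<partial>lebesgue_on {0<..}))" (is ?Q)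
proof -
  let ?z = "\<omega> / y"
  let ?f = "\<lambda>x. exp (p * x - exp x - (?z * exp x) powr \<nu>)"
  have z: "?z > 0" using \<omega> y by simp
  note mb = mellin_barnes_log[OF c \<nu> z]
  have f: "?f absolutely_integrable_on UNIV"
    using mb(1) integrable_completion[of ?f lborel] by (simp add: set_integrable_def)
  have intf: "integral UNIV ?f = (\<integral>x. ?f x \<partial>lborel)"
    using set_lebesgue_integral_eq_integral(2)[OF f] integral_completion[of ?f lborel]
    by (simp add: set_lebesgue_integral_def)
  let ?g = "\<lambda>u. ln (y * u)"
  have img: "?g ` {0<..} = UNIV"
  proof -
    have "x = ?g (exp x / y)" "exp x / y \<in> {0<..}" for x using y by auto
    thus ?thesis by blast
  qed
  have "(\<lambda>u. \<bar>1 / u\<bar> *\<^sub>R ?f (?g u)) absolutely_integrable_on {0<..} \<and>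
        integral {0<..} (\<lambda>u. \<bar>1 / u\<bar> *\<^sub>R ?f (?g u)) = (\<integral>x. ?f x \<partial>lborel)"
    using f intf y
    by (subst has_absolute_integral_change_of_variables_real)
       (auto intro!: derivative_eq_intros simp: img inj_on_def)
  hence A: "set_integrable lebesgue {0<..} (\<lambda>u. \<bar>1 / u\<bar> *\<^sub>R ?f (?g u))"
    "integral {0<..} (\<lambda>u. \<bar>1 / u\<bar> *\<^sub>R ?f (?g u)) = (\<integral>x. ?f x \<partial>lborel)"
    by (rule conjunct1, rule conjunct2)
  have eq: "\<bar>1 / u\<bar> *\<^sub>R ?f (?g u) = y powr p * k u" if "u > 0" for u
  proof -
    have "exp (p * ?g u) = y powr p * u powr p"
      using y that by (simp add: powr_def ln_mult algebra_simps exp_add)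
    moreover have "u powr p = u powr (p - 1) * u"
      using that by (simp add: powr_diff)
    moreover have "(?z * exp (?g u)) powr \<nu> = \<omega> powr \<nu> * u powr \<nu>"
      using that y \<omega> by (simp add: powr_mult)
    moreover have "exp (?g u) = y * u" using that y by simp
    ultimately show ?thesis
      using that by (simp add: k_def exp_diff exp_minus exp_add field_simps)
  qed
  have k1: "set_integrable lebesgue {0<..} (\<lambda>u. y powr p * k u)"
    using A(1) eq by (subst set_integrable_cong[OF refl refl]) auto
  have "(LINT u:{0<..}|lebesgue. y powr p * k u) = (\<integral>x. ?f x \<partial>lborel)"
    using A(2) eq unfolding set_lebesgue_integral_eq_integral(2)[OF A(1), symmetric]
    by (subst (asm) set_lebesgue_integral_cong[of _ _ _ "\<lambda>u. y powr p * k u"]) auto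
  hence k2: "y powr p * (\<integral>u. k u \<partial>lebesgue_on {0<..}) = (\<integral>x. ?f x \<partial>lborel)"
    by (simp add: integral_restrict_space set_lebesgue_integral_def)
  have "set_integrable lebesgue {0<..} (\<lambda>u. inverse (y powr p) * (y powr p * k u))"
    using k1 by (intro set_integrable_mult_right) auto
  moreover have "(\<lambda>u. inverse (y powr p) * (y powr p * k u)) = k"
    using y by (auto simp: fun_eq_iff simp flip: mult.assoc)
  ultimately show ?P by (simp add: integrable_restrict_space set_integrable_def)
  have "H11 c (of_real (1 - p)) 1 0 (1 / \<nu>) (of_real ?z) =
        1 / (2 * of_real pi * \<i>) * (\<integral>t. Gamma (of_real (1 / \<nu>) * Complex c t) * Gamma (of_real p - Complex c t)
             * of_real ?z powr - Complex c t * \<i> \<partial>lebesgue)"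
    by (simp add: H11_def Let_def)
  \<comment> \<open>The factor i from d\<theta> = i dt cancels the one in 1/(2 pi i).\<close>
  also have "\<dots> = 1 / (2 * of_real pi) * (\<integral>t. Gamma (of_real (1 / \<nu>) * Complex c t) * Gamma (of_real p - Complex c t)
             * of_real ?z powr - Complex c t \<partial>lebesgue)"
    by (simp only: integral_mult_left_zero) (simp add: field_simps)
  \<comment> \<open>\<open>H11\<close> integrates over \<open>lebesgue\<close>,
    \<open>mellin_barnes_log\<close> over \<open>lborel\<close>; Borel measurability of the
    integrand makes the two integrals agree.\<close>
  also have "\<dots> = 1 / (2 * of_real pi) * of_real (2 * pi * \<nu> * (\<integral>x. ?f x \<partial>lborel))"
    by (subst integral_completion) (use mb(2,3) in simp_all)
  also have "\<dots> = of_real (\<nu> * (\<integral>x. ?f x \<partial>lborel))" by simp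
  finally show ?Q unfolding k2[symmetric] by (simp add: mult_ac)
qed

subsection \<open>Exchanging the integrals\<close>

text \<open>Fubini's theorem on restrictions of \<open>lebesgue\<close> requires sigma-finiteness.
  Completion preserves the measure of Borel sets, so a countable cover for \<open>lborel\<close>
  serves again.\<close>

lemma sigma_finite_lebesgue: "sigma_finite_measure (lebesgue :: 'a::euclidean_space measure)"
proof
  obtain A :: "'a set set" where A: "countable A" "A \<subseteq> sets lborel" "\<Union>A = space lborel"
    "\<And>a. a \<in> A \<Longrightarrow> emeasure lborel a \<noteq> \<infinity>"
    using lborel.sigma_finite_countable by metis
  show "\<exists>A. countable A \<and> A \<subseteq> sets (lebesgue :: 'a measure) \<and> \<Union>A = space lebesgue \<and> (\<forall>a\<in>A. emeasure lebesgue a \<noteq> \<infinity>)"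
    using A by (intro exI[of _ A]) (auto simp: subset_eq)
qed

lemma integrable_lebesgue_on_iff:
  fixes f :: "'a::euclidean_space \<Rightarrow> 'b::{banach, second_countable_topology}"
  assumes "S \<in> sets lebesgue"
  shows "integrable (lebesgue_on S) f \<longleftrightarrow> set_integrable lebesgue S f"
  using assms by (simp add: integrable_restrict_space set_integrable_def)

lemma integral_lebesgue_on:
  fixes f :: "'a::euclidean_space \<Rightarrow> 'b::{banach, second_countable_topology}"
  assumes "S \<in> sets lebesgue"
  shows "(\<integral>x. f x \<partial>lebesgue_on S) = (LINT x:S|lebesgue. f x)"
  using assms by (simp add: integral_restrict_space set_lebesgue_integral_def)

text \<open>Since \<open>w\<close> and the exponential are positive, integrating the modulus of the
  double integrand over u gives exactly the modulus of E x times \<kappa> x. The assumption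
  \<open>int\<close> is thus absolute convergence of the double integral, and Fubini's theorem
  exchanges the order.\<close>

lemma exp_kernel_fubini:
  fixes E :: "real \<Rightarrow> complex" and w :: "real \<Rightarrow> real" and s :: real
  defines "M \<equiv> lebesgue_on {0<..}"
  defines "\<kappa> \<equiv> \<lambda>x. \<integral>u. exp (- (s * x * u)) * w u \<partial>M"
  defines "h \<equiv> \<lambda>u. \<integral>x. E x * of_real (exp (- (s * x * u))) \<partial>M"
  assumes E[measurable]: "E \<in> borel_measurable M" and w[measurable]: "w \<in> borel_measurable M"
    and w_pos: "\<And>u. u > 0 \<Longrightarrow> w u > 0" and s: "s > 0"
    and int_w: "\<And>x. x > 0 \<Longrightarrow> integrable M (\<lambda>u. exp (- (s * x * u)) * w u)"
    and int: "integrable M (\<lambda>x. E x * of_real (\<kappa> x))"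
  shows "\<And>u. u > 0 \<Longrightarrow> integrable M (\<lambda>x. E x * of_real (exp (- (s * x * u))))"
    and "integrable M (\<lambda>u. of_real (w u) * h u)"
    and "(\<integral>u. of_real (w u) * h u \<partial>M) = (\<integral>x. E x * of_real (\<kappa> x) \<partial>M)"
proof -
  interpret sigma_finite_measure M
    unfolding M_def by (rule sigma_finite_measure_restrict_space[OF sigma_finite_lebesgue]) simp
  interpret P: pair_sigma_finite M M ..
  have [measurable]: "(\<lambda>x. x) \<in> M \<rightarrow>\<^sub>M borel"
    unfolding M_def by (intro measurable_restrict_space1 measurable_completion) simp
  have pos: "x > 0" if "x \<in> space M" for x
    using that by (simp add: M_def space_restrict_space)
  let ?F = "\<lambda>x u. E x * of_real (exp (- (s * x * u)) * w u)"
  have norm_F: "norm (?F x u) = norm (E x) * (exp (- (s * x * u)) * w u)" if "u \<in> space M" for x u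
    using w_pos[OF pos[OF that]] by (simp add: norm_mult)
  have F_u: "integrable M (\<lambda>u. ?F x u)" if "x \<in> space M" for x
    using int_w[OF pos[OF that]] by (intro integrable_mult_right integrable_of_real)
  have intF: "integrable (M \<Otimes>\<^sub>M M) (\<lambda>(x, u). ?F x u)"
  proof (rule P.Fubini_integrable)
    have "(\<integral>u. norm (?F x u) \<partial>M) = norm (E x * of_real (\<kappa> x))" if "x \<in> space M" for x
    proof -
      have "\<kappa> x \<ge> 0"
        unfolding \<kappa>_def using w_pos pos by (intro integral_nonneg_AE AE_I2) (auto intro: less_imp_le)
      moreover have "(\<integral>u. norm (?F x u) \<partial>M) = (\<integral>u. norm (E x) * (exp (- (s * x * u)) * w u) \<partial>M)"
        by (intro Bochner_Integration.integral_cong refl norm_F)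
      ultimately show ?thesis by (simp add: \<kappa>_def norm_mult)
    qed
    thus "integrable M (\<lambda>x. \<integral>u. norm (case (x, u) of (x, u) \<Rightarrow> ?F x u) \<partial>M)"
      using integrable_norm[OF int] by (subst Bochner_Integration.integrable_cong[OF refl]) auto
    show "AE x in M. integrable M (\<lambda>u. case (x, u) of (x, u) \<Rightarrow> ?F x u)"
      using F_u by (intro AE_I2) simp
  qed measurable
  have h: "(\<integral>x. ?F x u \<partial>M) = of_real (w u) * h u" for u
  proof -
    have "?F x u = of_real (w u) * (E x * of_real (exp (- (s * x * u))))" for x
      by simp
    thus ?thesis unfolding h_def by (simp only: integral_mult_right_zero)
  qed
  show "integrable M (\<lambda>u. of_real (w u) * h u)"
    using P.integrable_snd[OF intF] by (simp only: h prod.case)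
  have "(\<integral>u. of_real (w u) * h u \<partial>M) = (\<integral>u. \<integral>x. ?F x u \<partial>M \<partial>M)"
    by (simp only: h)
  also have "\<dots> = (\<integral>x. \<integral>u. ?F x u \<partial>M \<partial>M)"
    by (rule P.Fubini_integral[OF intF])
  also have "\<dots> = (\<integral>x. E x * of_real (\<kappa> x) \<partial>M)"
    unfolding \<kappa>_def by (simp only: integral_mult_right_zero integral_complex_of_real)
  finally show "(\<integral>u. of_real (w u) * h u \<partial>M) = (\<integral>x. E x * of_real (\<kappa> x) \<partial>M)" .

  fix u :: real assume u: "u > 0"
  \<comment> \<open>Fubini's theorem only gives almost every parameter, but the integrals are monotone in it,
    so a good parameter below the given one suffices.\<close>
  have "AE u in M. integrable M (\<lambda>x. ?F x u)"
    using P.AE_integrable_snd[OF intF] by simp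
  hence "AE u in lebesgue. u > 0 \<longrightarrow> integrable M (\<lambda>x. ?F x u)"
    unfolding M_def by (subst (asm) AE_restrict_space_iff) auto
  then obtain N where N: "N \<in> null_sets lebesgue" "{u. \<not> (u > 0 \<longrightarrow> integrable M (\<lambda>x. ?F x u))} \<subseteq> N"
    unfolding eventually_ae_filter by auto
  have "\<not> {0<..<u} \<subseteq> N"
  proof
    assume "{0<..<u} \<subseteq> N"
    hence "emeasure lebesgue {0<..<u} \<le> emeasure lebesgue N"
      using N(1) by (intro emeasure_mono) auto
    thus False using null_setsD1[OF N(1)] u by simp
  qed
  then obtain r where "r \<in> {0<..<u}" "r \<notin> N"
    by blast
  with N(2) have r: "0 < r" "r < u" "integrable M (\<lambda>x. ?F x r)"
    unfolding greaterThanLessThan_iff by blast+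
  \<comment> \<open>At fixed r the weight \<open>w r\<close> is a nonzero constant. Dividing it out
    leaves an integrable function that dominates the one at u, because r < u.\<close>
  have "integrable M (\<lambda>x. ?F x r * of_real (inverse (w r)))"
    by (intro integrable_mult_left r)
  also have "(\<lambda>x. ?F x r * of_real (inverse (w r))) = (\<lambda>x. E x * of_real (exp (- (s * x * r))))"
    using w_pos[OF r(1)] by (auto simp: fun_eq_iff)
  finally show "integrable M (\<lambda>x. E x * of_real (exp (- (s * x * u))))"
  proof (rule Bochner_Integration.integrable_bound)
    show "AE x in M. norm (E x * of_real (exp (- (s * x * u)))) \<le> norm (E x * of_real (exp (- (s * x * r))))"
      using pos r s by (intro AE_I2) (auto simp: norm_mult intro!: mult_left_mono)
  qed measurable
qed

text \<open>The substitution exp x = (\<omega> u)^\<nu> turns this into Euler's integral for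
  Gamma(\<mu>). It is the borderline case y = 0 of the Laplace kernel, and supplies a bound on the
  kernel that is uniform in its argument.\<close>

lemma integrable_stretched_exp_powr:
  assumes \<nu>: "\<nu> > 0" and \<mu>: "\<mu> > 0" and \<omega>: "\<omega> > 0"
  shows "integrable (lebesgue_on {0<..}) (\<lambda>u::real. exp (- (\<omega> powr \<nu> * u powr \<nu>)) * u powr (\<nu> * \<mu> - 1))"
proof -
  let ?f = "\<lambda>x::real. exp (\<mu> * x - exp x)"
  let ?k = "\<lambda>u::real. exp (- (\<omega> powr \<nu> * u powr \<nu>)) * u powr (\<nu> * \<mu> - 1)"
  have "integrable lborel ?f"
    using integrable_norm[OF Gamma_integral_exp_substitution(1)[of "of_real \<mu>"]] \<mu> by simp
  hence f: "?f absolutely_integrable_on UNIV"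
    using integrable_completion[of ?f lborel] by (simp add: set_integrable_def)
  let ?g = "\<lambda>u. \<nu> * ln (\<omega> * u)"
  have img: "?g ` {0<..} = UNIV"
  proof -
    have "x = ?g (exp (x / \<nu>) / \<omega>)" "exp (x / \<nu>) / \<omega> \<in> {0<..}" for x using \<omega> \<nu> by auto
    thus ?thesis by blast
  qed
  have "(\<lambda>u. \<bar>\<nu> / u\<bar> *\<^sub>R ?f (?g u)) absolutely_integrable_on {0<..}"
    using f \<omega> \<nu>
    by (subst absolutely_integrable_change_of_variables_real[symmetric])
       (auto intro!: derivative_eq_intros simp: img inj_on_def)
  hence "set_integrable lebesgue {0<..} (\<lambda>u. inverse (\<nu> * \<omega> powr (\<nu> * \<mu>)) * (\<bar>\<nu> / u\<bar> *\<^sub>R ?f (?g u)))"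
    by (intro set_integrable_mult_right) auto
  moreover have "inverse (\<nu> * \<omega> powr (\<nu> * \<mu>)) * (\<bar>\<nu> / u\<bar> *\<^sub>R ?f (?g u)) = ?k u" if "u > 0" for u
  proof -
    have "exp (\<mu> * ?g u) = \<omega> powr (\<nu> * \<mu>) * u powr (\<nu> * \<mu>)"
      using \<omega> that by (simp add: powr_def ln_mult algebra_simps exp_add)
    moreover have "u powr (\<nu> * \<mu>) = u powr (\<nu> * \<mu> - 1) * u"
      using that by (simp add: powr_diff)
    moreover have "exp (?g u) = \<omega> powr \<nu> * u powr \<nu>"
      using \<omega> that by (simp add: powr_def ln_mult algebra_simps exp_add)
    ultimately show ?thesis
      using that \<nu> \<omega> by (simp add: exp_diff exp_minus field_simps)
  qed
  ultimately have "set_integrable lebesgue {0<..} ?k"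
    by (subst (asm) set_integrable_cong[OF refl refl]) auto
  thus ?thesis by (subst integrable_lebesgue_on_iff) auto
qed

text \<open>Convergence is part of the claim because an equation by itself could hold between
  default values of divergent integrals. The growth bound controls g only beyond T, so behaviour at
  0 enters the first implication as integrability up to T/\<omega>, the point that scaling by
  \<omega> sends to T; there a > 1/\<beta> secures the tail. The second implication derives the
  left-hand transforms and the identity from convergence of the right-hand side.\<close>

theorem corollary3p3:
  fixes \<rho> v :: complex and m :: nat and g :: "real \<Rightarrow> complex"
    and K T \<beta> a \<nu> \<mu> \<omega> c :: real
  assumes "Re \<rho> > 0" and "m \<ge> 1" and "\<omega> > 0"
    and "K > 0" and "T > 0" and "\<beta> > 0"
    and "a > 0" and "\<nu> > 0" and "\<mu> > 0"
    and contour: "0 < c" "c < \<nu> * \<mu>"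
    and measurable: "g \<in> borel_measurable (lebesgue_on {0<..})"
    and growth: "\<And>x. x > T \<Longrightarrow> norm (g x) \<le> K * x powr (real m * Re \<rho>) * exp (x / \<beta>)"
  shows
    "let L = (\<lambda>x. of_real (exp (- (a * x))) * g x);
         R = (\<lambda>x. g x / of_real (x powr (\<nu> * \<mu>)) *
                H11 c (of_real (1 - \<nu> * \<mu>)) 1 0 (1 / \<nu>) (of_real (\<omega> / x)))
     in (1 / \<beta> < a \<and>
         (\<lambda>x. exp (- (v / of_real x)) * g (\<omega> * x)) absolutely_integrable_on {0<..T / \<omega>} \<longrightarrow>
           M_converges \<rho> m R (of_real (a * \<omega>)) v \<omega>) \<and>
        (M_converges \<rho> m R (of_real (a * \<omega>)) v \<omega> \<longrightarrow>
           (\<forall>u>0. M_converges \<rho> m L (of_real (u * \<omega>)) v \<omega>) \<and>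
           BD_converges \<nu> \<mu> (\<lambda>u. M_transform \<rho> m L (of_real (u * \<omega>)) v \<omega>) \<omega> \<and>
           BD_transform \<nu> \<mu> (\<lambda>u. M_transform \<rho> m L (of_real (u * \<omega>)) v \<omega>) \<omega> =
             of_real (\<omega> powr (\<nu> * \<mu> - 1)) * M_transform \<rho> m R (of_real (a * \<omega>)) v \<omega>)"
proof -
  define L where "L = (\<lambda>x. of_real (exp (- (a * x))) * g x)"
  define R where "R = (\<lambda>x. g x / of_real (x powr (\<nu> * \<mu>)) *
                H11 c (of_real (1 - \<nu> * \<mu>)) 1 0 (1 / \<nu>) (of_real (\<omega> / x)))"
  define M where "M = lebesgue_on {0::real<..}"
  define w where "w u = exp (- (\<omega> powr \<nu> * u powr \<nu>)) * u powr (\<nu> * \<mu> - 1)" for u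
  define \<kappa> where "\<kappa> x = (\<integral>u. exp (- (\<omega> * x * u)) * w u \<partial>M)" for x
  define D where "D x = complex_of_real (x ^ m + \<omega> ^ m) powr \<rho>" for x
  \<comment> \<open>The common part of both integrands. The decay exp(-a \<omega> x) is the
    exponential of the transform at a \<omega> on the right, and the value at \<omega> x of the
    factor exp(-a x) of \<open>L\<close> on the left.\<close>
  define E where "E x = exp (- (of_real (a * \<omega>) * of_real x) - v / of_real x) / D x * g (\<omega> * x)" for x
  have S: "{0::real<..} \<in> sets lebesgue" by simp
  have pos: "x > 0" if "x \<in> space M" for x
    using that by (simp add: M_def space_restrict_space)
  have int_w: "integrable M w"
    unfolding M_def w_def by (rule integrable_stretched_exp_powr) fact+
  have kernel: "integrable M (\<lambda>u. exp (- (\<omega> * x * u)) * w u)"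
    "H11 c (of_real (1 - \<nu> * \<mu>)) 1 0 (1 / \<nu>) (of_real (\<omega> / (\<omega> * x))) =
       of_real (\<nu> * (\<omega> * x) powr (\<nu> * \<mu>) * \<kappa> x)" if "x > 0" for x
    using H11_eq_laplace_integral[OF contour \<open>\<nu> > 0\<close> \<open>\<omega> > 0\<close>, of "\<omega> * x"] that \<open>\<omega> > 0\<close>
    unfolding M_def \<kappa>_def w_def by auto
  have RI: "M_integrand \<rho> m R (of_real (a * \<omega>)) v \<omega> x = of_real \<nu> * (E x * of_real (\<kappa> x))" if "x > 0" for x
  proof -
    \<comment> \<open>The power of \<omega> x produced by the kernel representation cancels the
      denominator of \<open>R\<close>.\<close>
    have "R (\<omega> * x) = g (\<omega> * x) * of_real (\<nu> * \<kappa> x)"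
      unfolding R_def kernel(2)[OF that] using that \<open>\<omega> > 0\<close> by simp
    thus ?thesis by (simp add: M_integrand_def E_def D_def)
  qed
  have LI: "M_integrand \<rho> m L (of_real (u * \<omega>)) v \<omega> x = E x * of_real (exp (- (\<omega> * x * u)))" for u x
  proof -
    have "exp (- (of_real (u * \<omega>) * complex_of_real x) - v / of_real x) * of_real (exp (- (a * (\<omega> * x)))) =
          exp (- (of_real (a * \<omega>) * of_real x) - v / of_real x) * of_real (exp (- (\<omega> * x * u)))"
      by (simp flip: exp_of_real exp_add add: algebra_simps)
    thus ?thesis by (simp add: M_integrand_def L_def E_def D_def field_simps)
  qed
  have LT: "M_transform \<rho> m L (of_real (u * \<omega>)) v \<omega> = (\<integral>x. E x * of_real (exp (- (\<omega> * x * u))) \<partial>M)" for u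
    unfolding M_transform_def LI M_def integral_lebesgue_on[OF S] ..
  have BD: "BD_integrand \<nu> \<mu> (\<lambda>u. M_transform \<rho> m L (of_real (u * \<omega>)) v \<omega>) \<omega> =
            (\<lambda>u. of_real (w u) * (\<integral>x. E x * of_real (exp (- (\<omega> * x * u))) \<partial>M))"
    by (simp only: fun_eq_iff BD_integrand_def LT w_def) simp
  have RT: "M_transform \<rho> m R (of_real (a * \<omega>)) v \<omega> = of_real \<nu> * (\<integral>x. E x * of_real (\<kappa> x) \<partial>M)"
  proof -
    have "M_transform \<rho> m R (of_real (a * \<omega>)) v \<omega> = (LINT x:{0<..}|lebesgue. of_real \<nu> * (E x * of_real (\<kappa> x)))"
      unfolding M_transform_def by (rule set_lebesgue_integral_cong) (use RI in auto)
    thus ?thesis unfolding M_def integral_lebesgue_on[OF S] by simp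
  qed
  have RC: "M_converges \<rho> m R (of_real (a * \<omega>)) v \<omega> \<longleftrightarrow> integrable M (\<lambda>x. E x * of_real (\<kappa> x))"
  proof -
    have "M_converges \<rho> m R (of_real (a * \<omega>)) v \<omega> \<longleftrightarrow> integrable M (\<lambda>x. of_real \<nu> * (E x * of_real (\<kappa> x)))"
      unfolding M_converges_def M_def integrable_lebesgue_on_iff[OF S]
      by (intro set_integrable_cong) (use RI in auto)
    also have "\<dots> \<longleftrightarrow> integrable M (\<lambda>x. E x * of_real (\<kappa> x))"
    proof
      assume "integrable M (\<lambda>x. of_real \<nu> * (E x * of_real (\<kappa> x)))"
      from integrable_mult_right[OF this, of "inverse (of_real \<nu>)"]
      show "integrable M (\<lambda>x. E x * of_real (\<kappa> x))"
        using \<open>\<nu> > 0\<close> by (simp flip: mult.assoc)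
    qed (rule integrable_mult_right)
    finally show ?thesis .
  qed

  \<comment> \<open>Measurability of the integrand\<close>
  have D_pos: "x ^ m + \<omega> ^ m > 0" if "x > 0" for x
    using that \<open>\<omega> > 0\<close> by (intro add_pos_pos zero_less_power)
  \<comment> \<open>As g is only Lebesgue measurable, its composition with the scaling requires
    preimages of Lebesgue sets to be Lebesgue sets; Borel measurability of the scaling would be too
    weak.\<close>
  have scale: "(\<lambda>x. \<omega> * x) \<in> M \<rightarrow>\<^sub>M M"
  proof -
    have "(\<lambda>x. \<omega> *\<^sub>R x) \<in> lebesgue \<rightarrow>\<^sub>M (lebesgue :: real measure)"
      by (rule lebesgue_measurable_scaling)
    thus ?thesis
      unfolding M_def by (intro measurable_restrict_space3) (use \<open>\<omega> > 0\<close> in auto)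
  qed
  have g_scale: "(\<lambda>x. g (\<omega> * x)) \<in> borel_measurable M"
    using measurable_compose[OF scale measurable[folded M_def]] .
  have "(\<lambda>x. exp (- (of_real (a * \<omega>) * of_real x) - v / of_real x) / D x) \<in> borel_measurable M"
    unfolding M_def
  proof (rule continuous_imp_measurable_on_sets_lebesgue[OF _ S])
    \<comment> \<open>The base is a positive real, so the principal power can be written with the
      real logarithm and continuity meets no branch cut.\<close>
    have "continuous_on {0<..} (\<lambda>x. exp (\<rho> * of_real (ln (x ^ m + \<omega> ^ m))))"
      using D_pos by (intro continuous_intros) (auto simp: less_imp_neq[symmetric])
    moreover have "D x = exp (\<rho> * of_real (ln (x ^ m + \<omega> ^ m)))" if "x > 0" for x
      using D_pos[OF that] unfolding D_def powr_def
      by (subst Ln_of_real) (auto simp flip: of_real_power of_real_add)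
    ultimately have D: "continuous_on {0<..} D"
      by (subst continuous_on_cong[OF refl]) auto
    have "D x \<noteq> 0" if "x > 0" for x
      using D_pos[OF that] unfolding D_def by (simp flip: of_real_power of_real_add)
    thus "continuous_on {0<..} (\<lambda>x. exp (- (of_real (a * \<omega>) * of_real x) - v / of_real x) / D x)"
      using D by (intro continuous_intros) auto
  qed
  hence E_meas: "E \<in> borel_measurable M"
    unfolding E_def using g_scale by measurable
  have w_pos: "w u > 0" if "u > 0" for u
    using that by (simp add: w_def)
  have w_meas: "w \<in> borel_measurable M"
    using int_w by (rule borel_measurable_integrable)

  \<comment> \<open>The identity, from convergence of the right-hand side\<close>
  have part2: "(\<forall>u>0. M_converges \<rho> m L (of_real (u * \<omega>)) v \<omega>) \<and>
           BD_converges \<nu> \<mu> (\<lambda>u. M_transform \<rho> m L (of_real (u * \<omega>)) v \<omega>) \<omega> \<and>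
           BD_transform \<nu> \<mu> (\<lambda>u. M_transform \<rho> m L (of_real (u * \<omega>)) v \<omega>) \<omega> =
             of_real (\<omega> powr (\<nu> * \<mu> - 1)) * M_transform \<rho> m R (of_real (a * \<omega>)) v \<omega>"
    if "M_converges \<rho> m R (of_real (a * \<omega>)) v \<omega>"
  proof -
    note fubini = exp_kernel_fubini[of E w \<omega>, folded M_def, folded \<kappa>_def,
        OF E_meas w_meas w_pos \<open>\<omega> > 0\<close> kernel(1) that[unfolded RC]]
    have fub: "u > 0 \<Longrightarrow> integrable M (\<lambda>x. E x * of_real (exp (- (\<omega> * x * u))))"
      "integrable M (\<lambda>u. of_real (w u) * (\<integral>x. E x * of_real (exp (- (\<omega> * x * u))) \<partial>M))"
      "(\<integral>u. of_real (w u) * (\<integral>x. E x * of_real (exp (- (\<omega> * x * u))) \<partial>M) \<partial>M) = (\<integral>x. E x * of_real (\<kappa> x) \<partial>M)" for u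
      by (rule fubini; assumption)+
    have "M_converges \<rho> m L (of_real (u * \<omega>)) v \<omega>" if "u > 0" for u
      unfolding M_converges_def LI using fub(1)[of u] that by (simp add: M_def integrable_lebesgue_on_iff)
    moreover have "BD_converges \<nu> \<mu> (\<lambda>u. M_transform \<rho> m L (of_real (u * \<omega>)) v \<omega>) \<omega>"
      unfolding BD_converges_def BD using fub(2)
      by (subst integrable_lebesgue_on_iff[OF S, symmetric]) (simp add: M_def)
    \<comment> \<open>The prefactor \<nu> of the Borel-Dzhrbashjan transform matches the \<nu> that
      the kernel representation puts into \<open>RT\<close>; the power of \<omega> remains.\<close>
    moreover have "BD_transform \<nu> \<mu> (\<lambda>u. M_transform \<rho> m L (of_real (u * \<omega>)) v \<omega>) \<omega> =
             of_real (\<omega> powr (\<nu> * \<mu> - 1)) * M_transform \<rho> m R (of_real (a * \<omega>)) v \<omega>"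
      unfolding BD_transform_def BD RT fub(3)[symmetric]
      by (subst integral_lebesgue_on[OF S, symmetric]) (simp add: M_def)
    ultimately show ?thesis by blast
  qed

  \<comment> \<open>Convergence of the right-hand side under the growth condition\<close>
  have part1: "M_converges \<rho> m R (of_real (a * \<omega>)) v \<omega>"
    if a: "1 / \<beta> < a"
      and near0: "(\<lambda>x. exp (- (v / of_real x)) * g (\<omega> * x)) absolutely_integrable_on {0<..T / \<omega>}"
  proof -
    interpret sigma_finite_measure M
      unfolding M_def by (rule sigma_finite_measure_restrict_space[OF sigma_finite_lebesgue]) simp
    \<comment> \<open>The total mass of the weight bounds \<kappa> uniformly, because the
      exponential in the kernel is at most 1.\<close>
    define W where "W = (\<integral>u. w u \<partial>M)"
    have \<kappa>_nonneg: "\<kappa> x \<ge> 0" for x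
      unfolding \<kappa>_def using w_pos pos by (intro integral_nonneg_AE AE_I2) (auto intro: less_imp_le)
    have \<kappa>_le: "\<kappa> x \<le> W" if "x > 0" for x
      unfolding \<kappa>_def W_def
    proof (rule integral_mono)
      fix u assume "u \<in> space M"
      thus "exp (- (\<omega> * x * u)) * w u \<le> w u"
        using pos[of u] w_pos[of u] that \<open>\<omega> > 0\<close> by (intro mult_left_le_one_le) auto
    qed (use int_w kernel(1) that in auto)
    have W: "W \<ge> 0" using order_trans[OF \<kappa>_nonneg[of 1] \<kappa>_le[of 1]] by simp
    have [measurable]: "(\<lambda>x. x) \<in> M \<rightarrow>\<^sub>M borel"
      unfolding M_def by (intro measurable_restrict_space1 measurable_completion) simp
    have \<kappa>_meas: "\<kappa> \<in> borel_measurable M"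
      unfolding \<kappa>_def using w_meas by measurable
    let ?f = "\<lambda>x. E x * of_real (\<kappa> x)"
    have f_meas: "?f \<in> borel_measurable M"
      using E_meas \<kappa>_meas by measurable
    have f_set_meas: "set_borel_measurable lebesgue A ?f" if "A \<in> sets lebesgue" "A \<subseteq> {0<..}" for A
    proof -
      have "?f \<in> borel_measurable (lebesgue_on A)"
        using measurable_restrict_mono[OF f_meas[unfolded M_def] that(2)] .
      thus ?thesis using that(1)
        unfolding set_borel_measurable_def by (simp add: borel_measurable_restrict_space_iff)
    qed
    have norm_D: "norm (D x) = (x ^ m + \<omega> ^ m) powr Re \<rho>" if "x > 0" for x
      unfolding D_def using D_pos[OF that] by (subst norm_powr_real_powr) auto
    have norm_f: "norm (?f x) = exp (- (a * \<omega> * x)) * norm (exp (- (v / of_real x)) * g (\<omega> * x)) * \<kappa> x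
                    / (x ^ m + \<omega> ^ m) powr Re \<rho>" if "x > 0" for x
    proof -
      have "exp (- (of_real (a * \<omega>) * of_real x) - v / of_real x) = of_real (exp (- (a * \<omega> * x))) * exp (- (v / of_real x))"
        by (simp flip: exp_of_real exp_add)
      hence "?f x = of_real (exp (- (a * \<omega> * x))) * (exp (- (v / of_real x)) * g (\<omega> * x)) * of_real (\<kappa> x) / D x"
        by (simp add: E_def)
      also have "norm \<dots> = \<bar>exp (- (a * \<omega> * x))\<bar> * norm (exp (- (v / of_real x)) * g (\<omega> * x)) * \<bar>\<kappa> x\<bar> / norm (D x)"
        by (simp only: norm_mult norm_divide norm_of_real)
      finally show ?thesis
        using \<kappa>_nonneg[of x] by (simp only: norm_D[OF that] abs_of_nonneg exp_ge_zero)
    qed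

    \<comment> \<open>Near 0 the decaying exponential is at most 1, \<kappa> is at most W and the
      modulus of the denominator is at least that at x = 0; what remains is the function assumed
      integrable there.\<close>
    have "set_integrable lebesgue {0<..T / \<omega>} ?f"
    proof (rule set_integrable_bound)
      show "set_integrable lebesgue {0<..T / \<omega>}
              (\<lambda>x. W / (\<omega> ^ m) powr Re \<rho> * norm (exp (- (v / of_real x)) * g (\<omega> * x)))"
        by (intro set_integrable_mult_right set_integrable_norm near0)
      show "set_borel_measurable lebesgue {0<..T / \<omega>} ?f"
        by (rule f_set_meas) auto
      show "AE x in lebesgue. x \<in> {0<..T / \<omega>} \<longrightarrow> norm (?f x) \<le>
              norm (W / (\<omega> ^ m) powr Re \<rho> * norm (exp (- (v / of_real x)) * g (\<omega> * x)))"
      proof (intro AE_I2 impI)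
        fix x assume "x \<in> {0<..T / \<omega>}"
        hence x: "x > 0" by simp
        let ?n = "norm (exp (- (v / of_real x)) * g (\<omega> * x))"
        have "norm (?f x) \<le> 1 * ?n * W / (\<omega> ^ m) powr Re \<rho>"
          unfolding norm_f[OF x] using x \<open>\<omega> > 0\<close> \<open>a > 0\<close> \<open>Re \<rho> > 0\<close>
          by (intro frac_le mult_mono powr_mono2 \<kappa>_le \<kappa>_nonneg mult_nonneg_nonneg W) auto
        thus "norm (?f x) \<le> norm (W / (\<omega> ^ m) powr Re \<rho> * ?n)"
          using W by (simp add: abs_mult mult_ac)
      qed
    qed
    moreover have "set_integrable lebesgue {T / \<omega><..} ?f"
    proof (rule set_integrable_bound)
      \<comment> \<open>b is the surplus of the decay rate a \<omega> over the growth rate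
        \<omega>/\<beta>. C collects the bound of exp(-v/x) for x > T/\<omega>, the growth constant
        K, the power of \<omega> from the scaled argument, and W.\<close>
      define b where "b = (a - 1 / \<beta>) * \<omega>"
      define C where "C = exp (norm v * \<omega> / T) * K * \<omega> powr (real m * Re \<rho>) * W"
      have b: "b > 0" using a \<open>\<omega> > 0\<close> by (simp add: b_def)
      have "(\<lambda>x. exp (- b * x)) integrable_on {T / \<omega>..}"
        using integrable_on_exp_minus_to_infinity[OF b] .
      hence "set_integrable lebesgue {T / \<omega>..} (\<lambda>x. exp (- b * x))"
        by (intro nonnegative_absolutely_integrable_1) auto
      hence "set_integrable lebesgue {T / \<omega><..} (\<lambda>x. exp (- b * x))"
        by (rule set_integrable_subset) auto
      thus "set_integrable lebesgue {T / \<omega><..} (\<lambda>x. C * exp (- b * x))"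
        by (intro set_integrable_mult_right)
      have T\<omega>: "T / \<omega> > 0" using \<open>T > 0\<close> \<open>\<omega> > 0\<close> by simp
      show "set_borel_measurable lebesgue {T / \<omega><..} ?f"
        by (rule f_set_meas) (use T\<omega> in auto)
      show "AE x in lebesgue. x \<in> {T / \<omega><..} \<longrightarrow> norm (?f x) \<le> norm (C * exp (- b * x))"
      proof (intro AE_I2 impI)
        fix x assume "x \<in> {T / \<omega><..}"
        hence x: "T / \<omega> < x" "x > 0"
          using T\<omega> by auto
        hence x_gt: "T < \<omega> * x"
          using \<open>\<omega> > 0\<close> by (simp add: field_simps)
        have "norm (exp (- (v / of_real x))) \<le> exp (norm (- (v / complex_of_real x)))"
          by (rule norm_exp)
        also have "\<dots> = exp (norm v / x)"
          using x by (simp add: norm_divide)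
        also have "\<dots> \<le> exp (norm v / (T / \<omega>))"
          using x T\<omega> by (subst exp_le_cancel_iff, intro divide_left_mono mult_pos_pos) auto
        finally have 1: "norm (exp (- (v / complex_of_real x))) \<le> exp (norm v * \<omega> / T)"
          by simp
        \<comment> \<open>The polynomial growth allowed for g is absorbed by the denominator of the
          transform, leaving only exponentials to compare.\<close>
        have "(\<omega> * x) powr (real m * Re \<rho>) = \<omega> powr (real m * Re \<rho>) * (x ^ m) powr Re \<rho>"
          using x \<open>\<omega> > 0\<close> by (simp add: powr_mult powr_powr flip: powr_realpow)
        also have "\<dots> \<le> \<omega> powr (real m * Re \<rho>) * (x ^ m + \<omega> ^ m) powr Re \<rho>"
          using x \<open>\<omega> > 0\<close> \<open>Re \<rho> > 0\<close> by (intro mult_left_mono powr_mono2) auto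
        finally have 2: "(\<omega> * x) powr (real m * Re \<rho>) \<le> \<omega> powr (real m * Re \<rho>) * (x ^ m + \<omega> ^ m) powr Re \<rho>" .
        have "norm (g (\<omega> * x)) \<le> K * (\<omega> * x) powr (real m * Re \<rho>) * exp (\<omega> * x / \<beta>)"
          by (rule growth[OF x_gt])
        also have "\<dots> \<le> K * (\<omega> powr (real m * Re \<rho>) * (x ^ m + \<omega> ^ m) powr Re \<rho>) * exp (\<omega> * x / \<beta>)"
          using \<open>K > 0\<close> 2 by (intro mult_right_mono mult_left_mono) auto
        finally have 3: "norm (g (\<omega> * x)) \<le> K * (\<omega> powr (real m * Re \<rho>) * (x ^ m + \<omega> ^ m) powr Re \<rho>) * exp (\<omega> * x / \<beta>)" .
        have "norm (?f x) \<le> exp (- (a * \<omega> * x)) * (exp (norm v * \<omega> / T) *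
                (K * (\<omega> powr (real m * Re \<rho>) * (x ^ m + \<omega> ^ m) powr Re \<rho>) * exp (\<omega> * x / \<beta>))) * W
                / (x ^ m + \<omega> ^ m) powr Re \<rho>"
          unfolding norm_f[OF x(2)] unfolding norm_mult using x \<open>K > 0\<close>
          by (intro divide_right_mono mult_mono 1 3 \<kappa>_le \<kappa>_nonneg mult_nonneg_nonneg W) auto
        also have "\<dots> = C * (exp (- (a * \<omega> * x)) * exp (\<omega> * x / \<beta>))"
          using D_pos[OF x(2)] by (simp add: C_def)
        also have "exp (- (a * \<omega> * x)) * exp (\<omega> * x / \<beta>) = exp (- b * x)"
          by (simp add: b_def algebra_simps flip: exp_add)
        finally show "norm (?f x) \<le> norm (C * exp (- b * x))"
          by (rule order_trans) simp
      qed
    qed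
    ultimately have "set_integrable lebesgue ({0<..T / \<omega>} \<union> {T / \<omega><..}) ?f"
      by (rule set_integrable_Un) auto
    also have "{0<..T / \<omega>} \<union> {T / \<omega><..} = {0<..}"
      using \<open>T > 0\<close> \<open>\<omega> > 0\<close> by (intro ivl_disj_un) auto
    finally show ?thesis
      unfolding RC M_def integrable_lebesgue_on_iff[OF S] .
  qed
  show ?thesis
    unfolding Let_def using part1 part2 unfolding L_def R_def by blast
qed

end
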